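(* Let $G$ be a connected graph of order at least $2$ without true twins and let $H$ be a connected non-complete graph. (i) If $H$ has no universal vertex, then $\mathrm{gp}_{\rm o}(G\circ H)=\mathrm{gp}_{\rm o}(G)\,\mathrm{gp}_{\rm o}(K_1+H)$. (ii) If $\operatorname{diam}(H)=2$, then $\mathrm{gp}_{\rm o}(G\circ H)=\mathrm{gp}_{\rm o}(G)\,\mathrm{gp}_{\rm o}(H)$. (iii) If $H$ has no true twins, then $\mathrm{gp}_{\rm o}(G\circ H)=\mathrm{gp}_{\rm o}(G)\,\alpha(H)$.
   Context: All graphs are finite and simple, and (as a standing assumption of the paper) connected. For $X\subseteq V(G)$, two vertices $u,v$ are $X$-positionable if no shortest $u,v$-path has an internal vertex in $X$. $X$ is an outer general position set if every two vertices of $X$ are $X$-positionable and every $u\in X$, $v\in V(G)\setminus X$ are $X$-positionable; $\mathrm{gp}_{\rm o}$ is the maximum cardinality of such a set. Vertices $u,v$ are true twins if $N[u]=N[v]$. A universal vertex is adjacent to all other vertices. $K_1+H$ is the join of $K_1$ with $H$ (a new vertex adjacent to all of $V(H)$). $\alpha$ is the independence number. The lexicographic product $G\circ H$ has vertex set $V(G)\times V(H)$, with $(g,h)$ and $(g',h')$ adjacent iff either $gg'\in E(G)$, or $g=g'$ and $hh'\in E(H)$. *)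

theory Defs
  imports "Graph_Theory.Graph_Theory"
begin

text \<open>
  A finite simple graph is a \<^locale>\<open>pair_graph\<close>: a finite vertex set with a symmetric,
  irreflexive set of arcs, each edge being present as two opposite arcs. Such a graph is
  coerced to a general digraph by \<^const>\<open>with_proj\<close>. Distances are those of
  \<^const>\<open>wf_digraph.\<mu>\<close> for the constant arc weight one; they are extended reals.
\<close>

definition graph_dist :: "'a pair_pre_digraph \<Rightarrow> 'a \<Rightarrow> 'a \<Rightarrow> ereal" where
  "graph_dist G u v = wf_digraph.\<mu> (with_proj G) (\<lambda>_. 1) u v"

definition graph_diam :: "'a pair_pre_digraph \<Rightarrow> ereal" where
  "graph_diam G = (SUP u\<in>pverts G. SUP v\<in>pverts G. graph_dist G u v)"

definition shortest_path :: "'a pair_pre_digraph \<Rightarrow> 'a \<Rightarrow> ('a \<times> 'a) awalk \<Rightarrow> 'a \<Rightarrow> bool" where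
  "shortest_path G u p v \<longleftrightarrow>
     pre_digraph.apath (with_proj G) u p v \<and> ereal (real (length p)) = graph_dist G u v"

definition positionable :: "'a pair_pre_digraph \<Rightarrow> 'a set \<Rightarrow> 'a \<Rightarrow> 'a \<Rightarrow> bool" where
  "positionable G X u v \<longleftrightarrow>
     (\<forall>p. shortest_path G u p v \<longrightarrow> set (pre_digraph.inner_verts (with_proj G) p) \<inter> X = {})"

definition outer_gp_set :: "'a pair_pre_digraph \<Rightarrow> 'a set \<Rightarrow> bool" where
  "outer_gp_set G X \<longleftrightarrow> X \<subseteq> pverts G \<and>
     (\<forall>u\<in>X. \<forall>v\<in>X. u \<noteq> v \<longrightarrow> positionable G X u v) \<and>
     (\<forall>u\<in>X. \<forall>v\<in>pverts G - X. positionable G X u v)"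

definition outer_gp_number :: "'a pair_pre_digraph \<Rightarrow> nat" where
  "outer_gp_number G = Max (card ` {X. outer_gp_set G X})"

definition indep_set :: "'a pair_pre_digraph \<Rightarrow> 'a set \<Rightarrow> bool" where
  "indep_set G X \<longleftrightarrow> X \<subseteq> pverts G \<and> (\<forall>u\<in>X. \<forall>v\<in>X. (u, v) \<notin> parcs G)"

definition indep_number :: "'a pair_pre_digraph \<Rightarrow> nat" where
  "indep_number G = Max (card ` {X. indep_set G X})"

definition closed_nbhd :: "'a pair_pre_digraph \<Rightarrow> 'a \<Rightarrow> 'a set" where
  "closed_nbhd G u = insert u {v. (u, v) \<in> parcs G}"

definition true_twins :: "'a pair_pre_digraph \<Rightarrow> 'a \<Rightarrow> 'a \<Rightarrow> bool" where
  "true_twins G u v \<longleftrightarrow>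
     u \<in> pverts G \<and> v \<in> pverts G \<and> u \<noteq> v \<and> closed_nbhd G u = closed_nbhd G v"

definition universal_vertex :: "'a pair_pre_digraph \<Rightarrow> 'a \<Rightarrow> bool" where
  "universal_vertex G u \<longleftrightarrow> u \<in> pverts G \<and> (\<forall>v\<in>pverts G. v \<noteq> u \<longrightarrow> (u, v) \<in> parcs G)"

text \<open>The join of \<open>K\<^sub>1\<close> and \<open>G\<close>; the vertex of \<open>K\<^sub>1\<close> is \<^const>\<open>None\<close>.\<close>

definition join_K1 :: "'a pair_pre_digraph \<Rightarrow> 'a option pair_pre_digraph" where
  "join_K1 G =
     \<lparr> pverts = insert None (Some ` pverts G),
       parcs = map_prod Some Some ` parcs G \<union>
               {None} \<times> Some ` pverts G \<union> Some ` pverts G \<times> {None} \<rparr>"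

definition lex_product ::
    "'a pair_pre_digraph \<Rightarrow> 'b pair_pre_digraph \<Rightarrow> ('a \<times> 'b) pair_pre_digraph" where
  "lex_product G H =
     \<lparr> pverts = pverts G \<times> pverts H,
       parcs = {((g, h), (g', h')) | g h g' h'.
         g \<in> pverts G \<and> h \<in> pverts H \<and> g' \<in> pverts G \<and> h' \<in> pverts H \<and>
         ((g, g') \<in> parcs G \<or> g = g' \<and> (h, h') \<in> parcs H)} \<rparr>"

lemma pair_graphI:
  assumes "finite (pverts G)" and "parcs G \<subseteq> pverts G \<times> pverts G"
    and "\<And>u. (u, u) \<notin> parcs G" and "\<And>u v. (u, v) \<in> parcs G \<Longrightarrow> (v, u) \<in> parcs G"
  shows "pair_graph G"
proof
  show "finite (parcs G)"
    using assms(1,2) by (meson finite_SigmaI finite_subset)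
  show "symmetric (with_proj G)"
    using assms(4) by (auto simp: symmetric_def intro: symI)
  fix e assume "e \<in> parcs G"
  then show "fst e \<in> pverts G" "snd e \<in> pverts G" "fst e \<noteq> snd e"
    using assms(2,3) by (cases e; auto)+
qed (fact assms(1))

lemma (in pair_graph) parcs_sym: "(u, v) \<in> parcs G \<Longrightarrow> (v, u) \<in> parcs G"
  using pair_sym_arcs by (auto simp: symmetric_def dest: symD)

lemma (in pair_graph) parcs_irrefl: "(u, u) \<notin> parcs G"
  using pair_no_loops by fastforce

lemma pair_graph_join_K1:
  assumes "pair_graph G"
  shows "pair_graph (join_K1 G)"
proof -
  interpret pair_graph G by fact
  show ?thesis
    using pair_finite_verts parcs_irrefl parcs_sym
    by (intro pair_graphI) (auto simp: join_K1_def dest: in_arcsD1 in_arcsD2)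
qed

lemma pair_graph_lex_product:
  assumes "pair_graph G" and "pair_graph H"
  shows "pair_graph (lex_product G H)"
proof -
  interpret G: pair_graph G by fact
  interpret H: pair_graph H by fact
  show ?thesis
    using G.pair_finite_verts H.pair_finite_verts G.parcs_irrefl H.parcs_irrefl
      G.parcs_sym H.parcs_sym
    by (intro pair_graphI) (auto simp: lex_product_def)
qed

end

theory Submission
  imports Defs
begin

text \<open>
  A geodesic from a vertex of \<open>X\<close> through an inner vertex in \<open>X\<close> can be cut one step after that
  vertex, so \<open>X\<close> is an outer general position set iff its vertices are pairwise mutually
  maximally distant. Outer general position numbers are thereby clique numbers, and the relation
  factorises over the lexicographic product. Vertices in different fibres have the distance of
  their first components; adjacency in \<open>G\<close> is excluded for mutually maximally distant vertices
  because it would make them true twins, so only the first components matter. Vertices in the same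
  fibre have distance at most two, where mutual maximal distance means being nonadjacent or true
  twins. Hence the number of the product is that of \<open>G\<close> times the largest clique of the relation
  ``nonadjacent or true twins'' on \<open>H\<close>. Distances at most two also occur in \<open>K\<^sub>1 + H\<close> and in \<open>H\<close>
  of diameter two, which identifies that clique number in (i) and (ii); without true twins the
  cliques are the independent sets.
\<close>

section \<open>Hop distance\<close>

text \<open>Relation powers keep distances in the naturals and open walks to induction on the
  exponent. For unreachable pairs \<open>LEAST\<close> is unspecified, whence the reachability
  premises below.\<close>

definition hop_dist :: "'a rel \<Rightarrow> 'a \<Rightarrow> 'a \<Rightarrow> nat" where
  "hop_dist R u v = (LEAST n. (u, v) \<in> R ^^ n)"

lemma hop_dist_le: "(u, v) \<in> R ^^ n \<Longrightarrow> hop_dist R u v \<le> n"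
  unfolding hop_dist_def by (rule Least_le)

lemma relpow_hop_dist: "(u, v) \<in> R\<^sup>* \<Longrightarrow> (u, v) \<in> R ^^ hop_dist R u v"
  unfolding hop_dist_def by (auto intro: LeastI dest: rtrancl_imp_relpow)

lemma hop_dist_refl [simp]: "hop_dist R u u = 0"
  using hop_dist_le[of u u 0 R] by simp

lemma hop_dist_eq_0_iff: "(u, v) \<in> R\<^sup>* \<Longrightarrow> hop_dist R u v = 0 \<longleftrightarrow> u = v"
  using relpow_hop_dist[of u v R] by auto

lemma hop_dist_le_1_iff:
  assumes "(u, v) \<in> R\<^sup>*"
  shows "hop_dist R u v \<le> 1 \<longleftrightarrow> u = v \<or> (u, v) \<in> R"
proof
  assume "hop_dist R u v \<le> 1"
  then have "hop_dist R u v = 0 \<or> hop_dist R u v = 1" by linarith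
  then show "u = v \<or> (u, v) \<in> R"
    using relpow_hop_dist[OF assms] by auto
next
  assume "u = v \<or> (u, v) \<in> R"
  then show "hop_dist R u v \<le> 1"
    using hop_dist_le[of u v 1 R] by auto
qed

lemma hop_dist_le_2: "(u, w) \<in> R \<Longrightarrow> (w, v) \<in> R \<Longrightarrow> hop_dist R u v \<le> 2"
  by (rule hop_dist_le) (auto simp: numeral_2_eq_2)

lemma hop_dist_triangle:
  assumes "(u, v) \<in> R\<^sup>*" and "(v, w) \<in> R\<^sup>*"
  shows "hop_dist R u w \<le> hop_dist R u v + hop_dist R v w"
  using relpow_hop_dist[OF assms(1)] relpow_hop_dist[OF assms(2)]
  by (intro hop_dist_le) (auto simp: relpow_add)

lemma (in pair_wf_digraph) relpow_parcs_iff_awalk: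
  "u \<in> pverts G \<Longrightarrow> (u, v) \<in> parcs G ^^ n \<longleftrightarrow> (\<exists>p. awalk u p v \<and> length p = n)"
proof (induction n arbitrary: u)
  case 0
  then show ?case by (auto simp: awalk_Nil_iff)
next
  case (Suc n)
  have "(u, v) \<in> parcs G ^^ Suc n \<longleftrightarrow> (\<exists>w. (u, w) \<in> parcs G \<and> (w, v) \<in> parcs G ^^ n)"
    by (meson relpow_Suc_D2 relpow_Suc_I2)
  also have "\<dots> \<longleftrightarrow> (\<exists>w p. (u, w) \<in> parcs G \<and> awalk w p v \<and> length p = n)"
    using Suc.IH in_arcsD2 by blast
  also have "\<dots> \<longleftrightarrow> (\<exists>e p. awalk u (e # p) v \<and> length p = n)"
    by (auto simp: awalk_Cons_iff)
  also have "\<dots> \<longleftrightarrow> (\<exists>p. awalk u p v \<and> length p = Suc n)"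
    unfolding length_Suc_conv by blast
  finally show ?case .
qed

section \<open>Geodesics in connected graphs\<close>

locale connected_pair_graph = pair_graph +
  assumes rtrancl_parcs: "u \<in> pverts G \<Longrightarrow> v \<in> pverts G \<Longrightarrow> (u, v) \<in> (parcs G)\<^sup>*"

text \<open>Connectedness is strong connectedness of the symmetric closure; arcs already come in
  opposite pairs, so it passes to the graph itself.\<close>

lemma connected_pair_graphI:
  assumes "pair_graph G" and "Digraph_Component.connected (with_proj G)"
  shows "connected_pair_graph G"
proof -
  interpret pair_graph G by fact
  have "strongly_connected (with_proj G)"
    using assms(2) pair_sym_arcs by (rule symmetric_connected_imp_strongly_connected[rotated])
  then show ?thesis
    by unfold_locales
      (auto simp: strongly_connected_def reachable_def dest: rtrancl_on_rtranclI)
qed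

context connected_pair_graph
begin

abbreviation d :: "'a \<Rightarrow> 'a \<Rightarrow> nat" where
  "d \<equiv> hop_dist (parcs G)"

lemma hop_dist_le_length: "awalk u p v \<Longrightarrow> d u v \<le> length p"
  by (rule hop_dist_le) (use relpow_parcs_iff_awalk awalk_hd_in_verts in blast)

lemma obtain_geodesic:
  assumes "u \<in> pverts G" and "v \<in> pverts G"
  obtains p where "awalk u p v" and "length p = d u v"
  using relpow_hop_dist[OF rtrancl_parcs[OF assms]] assms(1)
  by (auto simp: relpow_parcs_iff_awalk)

lemma awalk_cost_one: "awalk_cost (\<lambda>_. 1) p = real (length p)"
  by (induction p) auto

text \<open>\<open>\<mu>\<close> is an infimum over all awalks; with unit weights
  \<open>d u v\<close> bounds it below and a geodesic attains it.\<close>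

lemma graph_dist_eq_hop_dist:
  assumes "u \<in> pverts G" and "v \<in> pverts G"
  shows "graph_dist G u v = ereal (real (d u v))"
  unfolding graph_dist_def \<mu>_def
proof (rule antisym)
  obtain p where "awalk u p v" "length p = d u v"
    using obtain_geodesic[OF assms] .
  then show "(INF p\<in>{p. awalk u p v}. ereal (awalk_cost (\<lambda>_. 1) p)) \<le> ereal (real (d u v))"
    by (intro INF_lower2[of p]) (auto simp: awalk_cost_one)
qed (auto intro!: INF_greatest simp: awalk_cost_one hop_dist_le_length)

text \<open>A repeated vertex would leave a nonempty cycle to cut out, and the rest would be shorter
  than the distance.\<close>

lemma geodesic_is_apath:
  assumes "awalk u p v" and "length p = d u v"
  shows "apath u p v"
proof (rule ccontr)
  assume "\<not> apath u p v"
  then obtain q r s w where "p = q @ r @ s" "r \<noteq> []" "awalk u q w" "awalk w s v"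
    using assms(1) awalk_not_distinct_decomp[of u p v] by (auto simp: apath_def)
  then show False
    using hop_dist_le_length[OF awalk_appendI[of u q w s v]] assms(2) by (cases r) auto
qed

lemma shortest_path_iff:
  assumes "u \<in> pverts G" and "v \<in> pverts G"
  shows "shortest_path G u p v \<longleftrightarrow> awalk u p v \<and> length p = d u v"
  using geodesic_is_apath graph_dist_eq_hop_dist[OF assms]
  by (auto simp: shortest_path_def intro: awalkI_apath)

end

section \<open>Mutually maximally distant vertices\<close>

text \<open>
  The ``mutually maximally distant'' relation of strong metric dimension: neither geodesic
  between the two vertices extends beyond its end.
\<close>

definition mmd :: "'a pair_pre_digraph \<Rightarrow> 'a \<Rightarrow> 'a \<Rightarrow> bool" where
  "mmd G u v \<longleftrightarrow>
     (\<forall>w. (v, w) \<in> parcs G \<longrightarrow> hop_dist (parcs G) u w \<le> hop_dist (parcs G) u v) \<and>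
     (\<forall>w. (u, w) \<in> parcs G \<longrightarrow> hop_dist (parcs G) v w \<le> hop_dist (parcs G) v u)"

definition nonadj_or_twins :: "'a pair_pre_digraph \<Rightarrow> 'a \<Rightarrow> 'a \<Rightarrow> bool" where
  "nonadj_or_twins G u v \<longleftrightarrow> ((u, v) \<in> parcs G \<longrightarrow> closed_nbhd G u = closed_nbhd G v)"

text \<open>Common form of the invariants to be compared. \<open>pairwise\<close> tests distinct
  elements only, so the diagonal of the relation never matters.\<close>

definition clique_number :: "'a set \<Rightarrow> ('a \<Rightarrow> 'a \<Rightarrow> bool) \<Rightarrow> nat" where
  "clique_number V R = Max (card ` {X. X \<subseteq> V \<and> pairwise R X})"

context connected_pair_graph
begin

text \<open>If a neighbour of \<open>x\<close> in \<open>X\<close> is farther from \<open>u\<close>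
  than \<open>x\<close>, a geodesic from \<open>u\<close> to \<open>x\<close> extends to it and has
  \<open>x\<close> inside. Conversely, the vertex following an inner \<open>x\<close> on a geodesic
  from \<open>u\<close> is farther from \<open>u\<close> than \<open>x\<close>.\<close>

lemma outer_gp_set_iff:
  "outer_gp_set G X \<longleftrightarrow> X \<subseteq> pverts G \<and> pairwise (mmd G) X"
proof (intro iffI conjI)
  assume X: "outer_gp_set G X"
  then show sub: "X \<subseteq> pverts G" by (simp add: outer_gp_set_def)
  have *: "d u w \<le> d u x" if ux: "u \<in> X" "x \<in> X" "u \<noteq> x" and xw: "(x, w) \<in> parcs G" for u x w
  proof (rule ccontr)
    assume far: "\<not> d u w \<le> d u x"
    have V: "u \<in> pverts G" "x \<in> pverts G" "w \<in> pverts G"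
      using ux sub xw in_arcsD2 by auto
    obtain q where q: "awalk u q x" "length q = d u x"
      using obtain_geodesic V(1,2) .
    have p: "awalk u (q @ [(x, w)]) w"
      using q(1) xw V by (intro awalk_appendI[of u q x]) (auto simp: awalk_simps)
    then have "shortest_path G u (q @ [(x, w)]) w"
      using far q(2) hop_dist_le_length[OF p] V by (subst shortest_path_iff) auto
    \<comment> \<open>Which clause of \<open>outer_gp_set\<close> applies depends on whether
      \<open>w\<close> lies in \<open>X\<close>; \<open>w\<close> differs from \<open>u\<close>
      because its distance from \<open>u\<close> is positive.\<close>
    moreover have "positionable G X u w"
      using X ux far V by (cases "w \<in> X"; cases "u = w") (auto simp: outer_gp_set_def)
    moreover have "q \<noteq> []"
      using q(1) \<open>u \<noteq> x\<close> by (auto simp: awalk_Nil_iff)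
    then have "x \<in> set (inner_verts (q @ [(x, w)]))"
      by (cases q) (auto simp: inner_verts_def)
    ultimately show False
      using \<open>x \<in> X\<close> by (auto simp: positionable_def)
  qed
  then show "pairwise (mmd G) X"
    by (auto simp: pairwise_def mmd_def)
next
  assume X: "X \<subseteq> pverts G \<and> pairwise (mmd G) X"
  have pos: "positionable G X u v" if uv: "u \<in> X" "v \<in> pverts G" for u v
    unfolding positionable_def
  proof (intro allI impI)
    fix p assume "shortest_path G u p v"
    moreover have u: "u \<in> pverts G" using uv X by auto
    ultimately have p: "awalk u p v" "length p = d u v"
      using uv by (auto simp: shortest_path_iff)
    show "set (inner_verts p) \<inter> X = {}"
    proof (rule ccontr)
      assume "set (inner_verts p) \<inter> X \<noteq> {}"
      then obtain x where x: "x \<in> X" "x \<in> set (tl (map fst p))"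
        by (auto simp: inner_verts_def)
      \<comment> \<open>\<open>inner_verts\<close> omits the start, so the arc \<open>e\<close>
        leaving \<open>x\<close> is found behind the first arc \<open>e0\<close>.\<close>
      then obtain e0 p' e where p': "p = e0 # p'" "e \<in> set p'" "x = fst e"
        by (cases p) auto
      then obtain a b where ab: "p' = a @ e # b"
        by (meson split_list)
      define w where "w = snd e"
      have e: "e = (x, w)" using p' by (simp add: w_def)
      have split: "p = (e0 # a) @ (x, w) # b"
        using p'(1) ab[unfolded e] by simp
      then obtain y where y: "awalk u (e0 # a) y" "awalk y ((x, w) # b) v"
        using p(1) awalk_append_iff by metis
      then have q: "awalk u (e0 # a) x" and xw: "(x, w) \<in> parcs G" and b: "awalk w b v"
        by (simp_all add: awalk_Cons_iff)
      have V: "x \<in> pverts G" "w \<in> pverts G"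
        using xw in_arcsD1 in_arcsD2 by auto
      have vw: "d u v \<le> d u w + length b"
        using hop_dist_triangle[OF rtrancl_parcs rtrancl_parcs, of u w v]
          hop_dist_le_length[OF b] u V uv by simp
      have vx: "d u v \<le> d u x + Suc (length b)"
        using hop_dist_triangle[OF rtrancl_parcs rtrancl_parcs, of u x v]
          hop_dist_le_length[of x "(x, w) # b" v] b xw u V uv by (simp add: awalk_Cons_iff)
      have len: "d u v = Suc (length a) + 1 + length b"
        using p(2) split by simp
      have le: "d u x \<le> Suc (length a)"
        using hop_dist_le_length[OF q] by simp
      \<comment> \<open>Were \<open>u = x\<close>, the rest of \<open>p\<close> from
        \<open>x\<close> would reach \<open>v\<close> in fewer arcs than the distance. Distinctness
        makes \<open>mmd\<close> available, and then the bound on \<open>d u v\<close> through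
        \<open>w\<close> falls below the length of \<open>p\<close>.\<close>
      have "u \<noteq> x" using vx len by auto
      then have "d u w \<le> d u x"
        using X uv x(1) xw by (auto simp: pairwise_def mmd_def)
      then show False
        using vw len le by linarith
    qed
  qed
  then show "outer_gp_set G X"
    using X by (auto simp: outer_gp_set_def)
qed

lemma outer_gp_number_eq: "outer_gp_number G = clique_number (pverts G) (mmd G)"
  by (simp add: outer_gp_number_def clique_number_def outer_gp_set_iff)

section \<open>Mutual maximal distance at distance at most two\<close>

lemma closed_nbhd_subset: "u \<in> pverts G \<Longrightarrow> closed_nbhd G u \<subseteq> pverts G"
  using in_arcsD2 by (auto simp: closed_nbhd_def)

lemma mem_closed_nbhd_iff:
  "u \<in> pverts G \<Longrightarrow> v \<in> pverts G \<Longrightarrow> v \<in> closed_nbhd G u \<longleftrightarrow> d u v \<le> 1"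
  using hop_dist_le_1_iff[OF rtrancl_parcs, of u v] by (auto simp: closed_nbhd_def)

text \<open>Adjacent vertices have distance 1, and not exceeding it means inclusion of closed
  neighbourhoods both ways. Nonadjacent ones have distance at least 2, which by \<open>near\<close>
  no neighbour exceeds. Asking for \<open>near\<close> only around \<open>u\<close> and
  \<open>v\<close> lets the lemma apply inside a single fibre.\<close>

lemma mmd_iff_nonadj_or_twins:
  assumes V: "u \<in> pverts G" "v \<in> pverts G" and "u \<noteq> v"
    and near: "\<And>w. w \<in> closed_nbhd G v \<Longrightarrow> d u w \<le> 2" "\<And>w. w \<in> closed_nbhd G u \<Longrightarrow> d v w \<le> 2"
  shows "mmd G u v \<longleftrightarrow> nonadj_or_twins G u v"
proof (cases "(u, v) \<in> parcs G")
  case True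
  then have vu: "(v, u) \<in> parcs G" by (rule parcs_sym)
  have dist: "d u v = 1" "d v u = 1"
    using True vu \<open>u \<noteq> v\<close> hop_dist_le_1_iff[OF rtrancl_parcs, of u v]
      hop_dist_le_1_iff[OF rtrancl_parcs, of v u] hop_dist_eq_0_iff[OF rtrancl_parcs, of u v]
      hop_dist_eq_0_iff[OF rtrancl_parcs, of v u] V by auto
  have sub: "(\<forall>w. (y, w) \<in> parcs G \<longrightarrow> d x w \<le> 1) \<longleftrightarrow> closed_nbhd G y \<subseteq> closed_nbhd G x"
    if "(x, y) \<in> parcs G" for x y
  proof -
    have "d x w \<le> 1 \<longleftrightarrow> w \<in> closed_nbhd G x" if "(y, w) \<in> parcs G" for w
      using mem_closed_nbhd_iff[of x w] that \<open>(x, y) \<in> parcs G\<close> in_arcsD1 in_arcsD2 by blast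
    then show ?thesis
      using that unfolding closed_nbhd_def by blast
  qed
  have "mmd G u v \<longleftrightarrow> closed_nbhd G v \<subseteq> closed_nbhd G u \<and> closed_nbhd G u \<subseteq> closed_nbhd G v"
    unfolding mmd_def dist sub[OF True] sub[OF vu] ..
  then show ?thesis
    using True by (auto simp: nonadj_or_twins_def)
next
  case False
  then have "(v, u) \<notin> parcs G" using parcs_sym by blast
  with False have "2 \<le> d u v" "2 \<le> d v u"
    using \<open>u \<noteq> v\<close> hop_dist_le_1_iff[OF rtrancl_parcs, of u v]
      hop_dist_le_1_iff[OF rtrancl_parcs, of v u] V by auto
  then have "mmd G u v"
    using near by (fastforce simp: mmd_def closed_nbhd_def)
  then show ?thesis
    using False by (simp add: nonadj_or_twins_def)
qed

text \<open>Next to an arc all distances in question are at most two, so the preceding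
  characterisation leaves only twins.\<close>

lemma mmd_adjacent_imp_true_twins:
  assumes "mmd G u v" and uv: "(u, v) \<in> parcs G"
  shows "true_twins G u v"
proof -
  have V: "u \<in> pverts G" "v \<in> pverts G" "u \<noteq> v" and vu: "(v, u) \<in> parcs G"
    using uv in_arcsD1 in_arcsD2 parcs_irrefl parcs_sym by auto
  have near: "d u w \<le> 2" if "w \<in> closed_nbhd G v" for w
    using that uv hop_dist_le_2[OF uv] hop_dist_le[of u v 1 "parcs G"] by (auto simp: closed_nbhd_def)
  have near': "d v w \<le> 2" if "w \<in> closed_nbhd G u" for w
    using that vu hop_dist_le_2[OF vu] hop_dist_le[of v u 1 "parcs G"] by (auto simp: closed_nbhd_def)
  have "nonadj_or_twins G u v"
    using mmd_iff_nonadj_or_twins[OF V near near'] assms(1) by simp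
  then show ?thesis
    using uv V by (simp add: nonadj_or_twins_def true_twins_def)
qed

end

section \<open>Cliques of a relation\<close>

lemma clique_number_ge:
  assumes "finite V" and "X \<subseteq> V" and "pairwise R X"
  shows "card X \<le> clique_number V R"
  unfolding clique_number_def using assms by (intro Max_ge) auto

lemma obtain_max_clique:
  assumes "finite V"
  obtains X where "X \<subseteq> V" and "pairwise R X" and "card X = clique_number V R"
proof -
  have "clique_number V R \<in> card ` {X. X \<subseteq> V \<and> pairwise R X}"
    unfolding clique_number_def using assms by (intro Max_in) (auto intro: exI[of _ "{}"])
  then show ?thesis using that by auto
qed

lemma clique_number_cong:
  assumes "\<And>u v. u \<in> V \<Longrightarrow> v \<in> V \<Longrightarrow> u \<noteq> v \<Longrightarrow> R u v \<longleftrightarrow> S u v"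
  shows "clique_number V R = clique_number V S"
proof -
  have "{X. X \<subseteq> V \<and> pairwise R X} = {X. X \<subseteq> V \<and> pairwise S X}"
    using assms by (auto simp: pairwise_def subset_iff)
  then show ?thesis by (simp add: clique_number_def)
qed

text \<open>The first components of a clique form an \<open>S\<close>-clique and each section over
  one of them is a \<open>T\<close>-clique, which bounds its size; a product of maximum cliques
  attains the bound.\<close>

lemma clique_number_Times:
  assumes fin: "finite V" "finite W"
    and outer: "\<And>g h g' h'. g \<in> V \<Longrightarrow> g' \<in> V \<Longrightarrow> h \<in> W \<Longrightarrow> h' \<in> W \<Longrightarrow> g \<noteq> g' \<Longrightarrow>
      R (g, h) (g', h') \<longleftrightarrow> S g g'"
    and inner: "\<And>g h h'. g \<in> V \<Longrightarrow> h \<in> W \<Longrightarrow> h' \<in> W \<Longrightarrow> h \<noteq> h' \<Longrightarrow>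
      R (g, h) (g, h') \<longleftrightarrow> T h h'"
  shows "clique_number (V \<times> W) R = clique_number V S * clique_number W T"
proof (rule antisym)
  obtain X where X: "X \<subseteq> V \<times> W" "pairwise R X" "card X = clique_number (V \<times> W) R"
    using obtain_max_clique fin by (metis finite_cartesian_product)
  have XD: "g \<in> V" "h \<in> W" if "(g, h) \<in> X" for g h
    using that X(1) by auto
  have XR: "R (g, h) (g', h')" if "(g, h) \<in> X" "(g', h') \<in> X" "(g, h) \<noteq> (g', h')" for g h g' h'
    using that X(2) by (auto simp: pairwise_def)
  have finX: "finite (fst ` X)" "finite (X `` {g})" for g
    using XD fin by (auto intro!: finite_subset[of "fst ` X" V] finite_subset[of "X `` {g}" W])
  have "card X = card (Sigma (fst ` X) (\<lambda>g. X `` {g}))"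
    by (rule arg_cong[of _ _ card]) force
  also have "\<dots> = (\<Sum>g\<in>fst ` X. card (X `` {g}))"
    using finX by (intro card_SigmaI) auto
  also have "\<dots> \<le> (\<Sum>g\<in>fst ` X. clique_number W T)"
  proof (rule sum_mono, rule clique_number_ge[OF fin(2)])
    fix g
    show "X `` {g} \<subseteq> W" using X(1) by auto
    show "pairwise T (X `` {g})"
      unfolding pairwise_def
    proof (intro ballI impI)
      fix h h' assume "h \<in> X `` {g}" "h' \<in> X `` {g}" "h \<noteq> h'"
      then show "T h h'"
        using XD[of g h] XD[of g h'] XR[of g h g h'] inner[of g h h'] by auto
    qed
  qed
  also have "\<dots> = card (fst ` X) * clique_number W T" by simp
  also have "\<dots> \<le> clique_number V S * clique_number W T"
  proof (rule mult_le_mono1, rule clique_number_ge[OF fin(1)])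
    show "fst ` X \<subseteq> V" using X(1) by auto
    show "pairwise S (fst ` X)"
      unfolding pairwise_def
    proof (intro ballI impI)
      fix g g' assume "g \<in> fst ` X" "g' \<in> fst ` X" "g \<noteq> g'"
      then obtain h h' where "(g, h) \<in> X" "(g', h') \<in> X" by force
      with \<open>g \<noteq> g'\<close> show "S g g'"
        using XD XR[of g h g' h'] outer[of g g' h h'] by auto
    qed
  qed
  finally show "clique_number (V \<times> W) R \<le> clique_number V S * clique_number W T"
    using X(3) by simp
next
  obtain A where A: "A \<subseteq> V" "pairwise S A" "card A = clique_number V S"
    using obtain_max_clique[OF fin(1)] .
  obtain B where B: "B \<subseteq> W" "pairwise T B" "card B = clique_number W T"
    using obtain_max_clique[OF fin(2)] .
  have "pairwise R (A \<times> B)"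
    unfolding pairwise_def
  proof (intro ballI impI)
    fix x y assume "x \<in> A \<times> B" "y \<in> A \<times> B" "x \<noteq> y"
    moreover obtain g h g' h' where "x = (g, h)" "y = (g', h')"
      by (cases x, cases y)
    ultimately show "R x y"
      using A(1,2) B(1,2) outer[of g g' h h'] inner[of g h h']
      by (cases "g = g'") (auto simp: pairwise_def)
  qed
  then have "card (A \<times> B) \<le> clique_number (V \<times> W) R"
    using A(1) B(1) fin by (intro clique_number_ge) auto
  then show "clique_number V S * clique_number W T \<le> clique_number (V \<times> W) R"
    using A(3) B(3) by (simp add: card_cartesian_product)
qed

section \<open>The lexicographic product\<close>

lemma pverts_lex_product [simp]: "pverts (lex_product G H) = pverts G \<times> pverts H"
  by (simp add: lex_product_def)

lemma parcs_lex_product_iff: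
  "((g, h), (g', h')) \<in> parcs (lex_product G H) \<longleftrightarrow>
     g \<in> pverts G \<and> h \<in> pverts H \<and> g' \<in> pverts G \<and> h' \<in> pverts H \<and>
     ((g, g') \<in> parcs G \<or> g = g' \<and> (h, h') \<in> parcs H)"
  by (simp add: lex_product_def)

text \<open>Projection sends an arc to an arc or to a single vertex, so a walk can only lose
  steps.\<close>

lemma relpow_lex_productD:
  "(x, y) \<in> parcs (lex_product G H) ^^ n \<Longrightarrow> \<exists>m\<le>n. (fst x, fst y) \<in> parcs G ^^ m"
proof (induction n arbitrary: y)
  case 0
  then show ?case by auto
next
  case (Suc n)
  then obtain z where z: "(x, z) \<in> parcs (lex_product G H) ^^ n" "(z, y) \<in> parcs (lex_product G H)"
    by auto
  then obtain m where m: "m \<le> n" "(fst x, fst z) \<in> parcs G ^^ m"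
    using Suc.IH by blast
  have "fst z = fst y \<or> (fst z, fst y) \<in> parcs G"
    using z(2) by (cases z; cases y) (auto simp: parcs_lex_product_iff)
  then show ?case
  proof
    assume "fst z = fst y"
    then show ?thesis using m by (metis le_SucI)
  next
    assume "(fst z, fst y) \<in> parcs G"
    then show ?thesis using m by (intro exI[of _ "Suc m"]) auto
  qed
qed

text \<open>The second component rests at \<open>h\<close> until the last arc, which may move it to
  any \<open>h'\<close>; hence the walk has to be nonempty.\<close>

lemma relpow_lex_productI:
  assumes "pair_graph G" and "(g, g') \<in> parcs G ^^ Suc n" and "h \<in> pverts H" and "h' \<in> pverts H"
  shows "((g, h), (g', h')) \<in> parcs (lex_product G H) ^^ Suc n"
  using assms(2,4)
proof (induction n arbitrary: g' h')
  case 0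
  interpret pair_graph G by fact
  show ?case using 0 assms(3) by (auto simp: parcs_lex_product_iff dest: in_arcsD1 in_arcsD2)
next
  case (Suc n)
  interpret pair_graph G by fact
  from Suc.prems obtain k where k: "(g, k) \<in> parcs G ^^ Suc n" "(k, g') \<in> parcs G"
    by auto
  have "((g, h), (k, h)) \<in> parcs (lex_product G H) ^^ Suc n"
    using Suc.IH k(1) assms(3) by blast
  moreover have "((k, h), (g', h')) \<in> parcs (lex_product G H)"
    using k(2) assms(3) Suc.prems in_arcsD1 in_arcsD2 by (auto simp: parcs_lex_product_iff)
  ultimately show ?case by (metis relpow_Suc_I)
qed

locale lex_product_graphs = G: connected_pair_graph G + H: connected_pair_graph H
  for G :: "'a pair_pre_digraph" and H :: "'b pair_pre_digraph" +
  assumes card_G: "card (pverts G) \<ge> 2"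
    and no_twins_G: "\<not> true_twins G g g'"
begin

lemma obtain_neighbour:
  assumes "g \<in> pverts G"
  obtains k where "(g, k) \<in> parcs G"
proof -
  have "pverts G \<noteq> {g}" using card_G by auto
  then obtain g' where "g' \<in> pverts G" "g' \<noteq> g" using assms by auto
  then have "(g, g') \<in> (parcs G)\<^sup>+"
    using G.rtrancl_parcs[OF assms] by (metis rtranclD)
  then show ?thesis using that by (meson tranclD)
qed

lemma arc_lift:
  "(g, k) \<in> parcs G \<Longrightarrow> h \<in> pverts H \<Longrightarrow> h' \<in> pverts H \<Longrightarrow>
    ((g, h), (k, h')) \<in> parcs (lex_product G H)"
  using G.in_arcsD1 G.in_arcsD2 by (auto simp: parcs_lex_product_iff)

lemma rtrancl_lex_product:
  assumes "g \<in> pverts G" "g' \<in> pverts G" "h \<in> pverts H" "h' \<in> pverts H"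
  shows "((g, h), (g', h')) \<in> (parcs (lex_product G H))\<^sup>*"
proof -
  \<comment> \<open>Beginning with a step to a neighbour makes the walk nonempty even when
    \<open>g = g'\<close>, so that it lifts.\<close>
  obtain k where k: "(g, k) \<in> parcs G" using obtain_neighbour assms(1) .
  have "(k, g') \<in> (parcs G)\<^sup>*"
    using G.in_arcsD2[OF k] assms(2) by (rule G.rtrancl_parcs)
  then obtain n where "(k, g') \<in> parcs G ^^ n" by (auto dest: rtrancl_imp_relpow)
  then have "(g, g') \<in> parcs G ^^ Suc n" using k by (rule relpow_Suc_I2[rotated])
  then show ?thesis
    using relpow_lex_productI[OF G.pair_graph_axioms] assms(3,4) by (meson relpow_imp_rtrancl)
qed

sublocale L: connected_pair_graph "lex_product G H"
proof -
  interpret pair_graph "lex_product G H"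
    by (rule pair_graph_lex_product[OF G.pair_graph_axioms H.pair_graph_axioms])
  show "connected_pair_graph (lex_product G H)"
    by unfold_locales (auto intro: rtrancl_lex_product)
qed

text \<open>Lifting a geodesic bounds the distance above, projecting one bounds it below. Distinct
  first components make the geodesic nonempty, as lifting requires.\<close>

lemma hop_dist_lex_product:
  assumes V: "g \<in> pverts G" "g' \<in> pverts G" "h \<in> pverts H" "h' \<in> pverts H" and "g \<noteq> g'"
  shows "L.d (g, h) (g', h') = G.d g g'"
proof (rule antisym)
  obtain n where n: "G.d g g' = Suc n"
    using hop_dist_eq_0_iff[OF G.rtrancl_parcs[OF V(1,2)]] \<open>g \<noteq> g'\<close> by (cases "G.d g g'") auto
  have "(g, g') \<in> parcs G ^^ Suc n"
    using relpow_hop_dist[OF G.rtrancl_parcs[OF V(1,2)]] n by simp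
  then show "L.d (g, h) (g', h') \<le> G.d g g'"
    unfolding n using V(3,4) by (intro hop_dist_le relpow_lex_productI[OF G.pair_graph_axioms])
next
  have "((g, h), (g', h')) \<in> parcs (lex_product G H) ^^ L.d (g, h) (g', h')"
    using V by (intro relpow_hop_dist rtrancl_lex_product)
  then obtain m where "m \<le> L.d (g, h) (g', h')" "(g, g') \<in> parcs G ^^ m"
    by (auto dest: relpow_lex_productD)
  then show "G.d g g' \<le> L.d (g, h) (g', h')"
    using hop_dist_le by (metis order_trans)
qed

lemma hop_dist_same_fibre:
  assumes "g \<in> pverts G" "h \<in> pverts H" "h' \<in> pverts H"
  shows "L.d (g, h) (g, h') \<le> 2"
proof -
  obtain k where k: "(g, k) \<in> parcs G" using obtain_neighbour assms(1) .
  then show ?thesis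
    using assms G.parcs_sym by (blast intro: hop_dist_le_2 arc_lift)
qed

section \<open>Mutual maximal distance in the product\<close>

lemma closed_nbhd_lex_product:
  assumes "g \<in> pverts G" "h \<in> pverts H"
  shows "closed_nbhd (lex_product G H) (g, h) =
    {k. (g, k) \<in> parcs G} \<times> pverts H \<union> {g} \<times> closed_nbhd H h"
  using assms G.in_arcsD2 H.in_arcsD2 by (auto simp: closed_nbhd_def parcs_lex_product_iff)

text \<open>A neighbour of a vertex of the fibre lies in an adjacent fibre, at distance 1 from the
  whole fibre, or in the fibre itself, at distance at most 2 from its vertices. So distance two is
  never exceeded, whatever the diameter of the product.\<close>

lemma mmd_same_fibre:
  assumes V: "g \<in> pverts G" "h \<in> pverts H" "h' \<in> pverts H" and "h \<noteq> h'"
  shows "mmd (lex_product G H) (g, h) (g, h') \<longleftrightarrow> nonadj_or_twins H h h'"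
proof -
  have near: "L.d (g, k) w \<le> 2"
    if k: "k \<in> pverts H" "k' \<in> pverts H" "w \<in> closed_nbhd (lex_product G H) (g, k')" for k k' w
  proof -
    obtain g'' h'' where w: "w = (g'', h'')" by (cases w)
    consider "(g, g'') \<in> parcs G" "h'' \<in> pverts H" | "g'' = g" "h'' \<in> pverts H"
      using k(3) closed_nbhd_lex_product[OF V(1) k(2)] H.closed_nbhd_subset[OF k(2)] w
      by auto
    then show ?thesis
    proof cases
      case 1
      then have "L.d (g, k) w \<le> 1"
        unfolding w using k(1) by (intro hop_dist_le) (auto intro: arc_lift)
      then show ?thesis by simp
    next
      case 2
      then show ?thesis using hop_dist_same_fibre[OF V(1) k(1)] w by simp
    qed
  qed
  have "mmd (lex_product G H) (g, h) (g, h') \<longleftrightarrow>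
      nonadj_or_twins (lex_product G H) (g, h) (g, h')"
    using V \<open>h \<noteq> h'\<close> near by (intro L.mmd_iff_nonadj_or_twins) auto
  also have "\<dots> \<longleftrightarrow> nonadj_or_twins H h h'"
  proof -
    \<comment> \<open>The parts outside the fibre agree and, \<open>G\<close> having no loops, do
      not meet it; only the parts inside are compared.\<close>
    have "(closed_nbhd (lex_product G H) (g, h) = closed_nbhd (lex_product G H) (g, h'))
        \<longleftrightarrow> closed_nbhd H h = closed_nbhd H h'"
      unfolding closed_nbhd_lex_product[OF V(1,2)] closed_nbhd_lex_product[OF V(1,3)]
      using G.parcs_irrefl[of g] by blast
    then show ?thesis
      using V G.parcs_irrefl by (auto simp: nonadj_or_twins_def parcs_lex_product_iff)
  qed
  finally show ?thesis .
qed

text \<open>Distances are those in \<open>G\<close> unless a step enters the fibre of the other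
  vertex. Such a step needs \<open>g\<close> and \<open>g'\<close> adjacent; mutual maximal distance
  in \<open>G\<close> would then make them true twins.\<close>

lemma mmd_different_fibres:
  assumes V: "g \<in> pverts G" "g' \<in> pverts G" "h \<in> pverts H" "h' \<in> pverts H" and "g \<noteq> g'"
  shows "mmd (lex_product G H) (g, h) (g', h') \<longleftrightarrow> mmd G g g'"
proof
  assume m: "mmd (lex_product G H) (g, h) (g', h')"
  have "G.d g w \<le> G.d g g'" if gw: "(g', w) \<in> parcs G" for w
  proof (cases "w = g")
    case False
    have "L.d (g, h) (w, h') \<le> L.d (g, h) (g', h')"
      using m arc_lift[OF gw V(4,4)] by (simp add: mmd_def)
    then show ?thesis
      using False V \<open>g \<noteq> g'\<close> G.in_arcsD2[OF gw] by (simp add: hop_dist_lex_product)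
  qed simp
  moreover have "G.d g' w \<le> G.d g' g" if gw: "(g, w) \<in> parcs G" for w
  proof (cases "w = g'")
    case False
    have "L.d (g', h') (w, h) \<le> L.d (g', h') (g, h)"
      using m arc_lift[OF gw V(3,3)] by (simp add: mmd_def)
    then show ?thesis
      using False V \<open>g \<noteq> g'\<close> G.in_arcsD2[OF gw] by (simp add: hop_dist_lex_product)
  qed simp
  ultimately show "mmd G g g'" by (simp add: mmd_def)
next
  assume m: "mmd G g g'"
  then have na: "(g, g') \<notin> parcs G" "(g', g) \<notin> parcs G"
    using G.mmd_adjacent_imp_true_twins no_twins_G G.parcs_sym by blast+
  \<comment> \<open>One half of \<open>mmd\<close>, with free names to serve both directions;
    nonadjacency keeps \<open>w\<close> out of the fibre of \<open>a\<close>.\<close>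
  have *: "L.d (a, k) w \<le> L.d (a, k) (b, l)"
    if "((b, l), w) \<in> parcs (lex_product G H)"
      "a \<in> pverts G" "k \<in> pverts H" "a \<noteq> b" "(b, a) \<notin> parcs G"
      "\<And>c. (b, c) \<in> parcs G \<Longrightarrow> G.d a c \<le> G.d a b" for a b k l w
  proof -
    obtain c j where w: "w = (c, j)" by (cases w)
    have V': "b \<in> pverts G" "l \<in> pverts H" "c \<in> pverts G" "j \<in> pverts H"
      and cases: "(b, c) \<in> parcs G \<or> b = c"
      using that(1) w by (auto simp: parcs_lex_product_iff)
    then have "a \<noteq> c" using that(4,5) by auto
    then show ?thesis
      using cases that V' w by (auto simp: hop_dist_lex_product)
  qed
  show "mmd (lex_product G H) (g, h) (g', h')"
    using *[of g' h' _ g h] *[of g h _ g' h'] V \<open>g \<noteq> g'\<close> na m by (simp add: mmd_def)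
qed

lemma outer_gp_number_lex_product:
  "outer_gp_number (lex_product G H) =
     outer_gp_number G * clique_number (pverts H) (nonadj_or_twins H)"
  unfolding L.outer_gp_number_eq G.outer_gp_number_eq pverts_lex_product
  by (rule clique_number_Times)
    (use G.pair_finite_verts H.pair_finite_verts mmd_same_fibre mmd_different_fibres in auto)

end

section \<open>The clique number of the second factor\<close>

context connected_pair_graph
begin

lemma outer_gp_number_diam_le_2:
  assumes "\<And>u v. u \<in> pverts G \<Longrightarrow> v \<in> pverts G \<Longrightarrow> d u v \<le> 2"
  shows "outer_gp_number G = clique_number (pverts G) (nonadj_or_twins G)"
  unfolding outer_gp_number_eq
  using assms closed_nbhd_subset by (intro clique_number_cong mmd_iff_nonadj_or_twins) blast+

lemma hop_dist_le_graph_diam: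
  assumes "graph_diam G = ereal (real k)" and "u \<in> pverts G" and "v \<in> pverts G"
  shows "d u v \<le> k"
proof -
  have "graph_dist G u v \<le> graph_diam G"
    unfolding graph_diam_def using assms(2,3) by (blast intro: SUP_upper2)
  then show ?thesis
    using assms by (simp add: graph_dist_eq_hop_dist)
qed

text \<open>Without twins the relation is nonadjacency on distinct vertices. Absence of loops covers
  the diagonal, which \<open>indep_set\<close> tests and \<open>pairwise\<close> does not.\<close>

lemma indep_number_no_twins:
  assumes "\<not> (\<exists>u v. true_twins G u v)"
  shows "indep_number G = clique_number (pverts G) (nonadj_or_twins G)"
proof -
  have "indep_set G X \<longleftrightarrow> X \<subseteq> pverts G \<and> pairwise (nonadj_or_twins G) X" for X
    using assms parcs_irrefl
    unfolding indep_set_def pairwise_def nonadj_or_twins_def true_twins_def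
    by (metis subsetD)
  then show ?thesis
    by (simp add: indep_number_def clique_number_def)
qed

section \<open>The join with a single vertex\<close>

lemma connected_pair_graph_join_K1: "connected_pair_graph (join_K1 G)"
proof -
  interpret J: pair_graph "join_K1 G"
    by (rule pair_graph_join_K1) (rule pair_graph_axioms)
  have to_None: "(u, None) \<in> (parcs (join_K1 G))\<^sup>*" "(None, u) \<in> (parcs (join_K1 G))\<^sup>*"
    if "u \<in> pverts (join_K1 G)" for u
    using that by (cases u; force simp: join_K1_def)+
  show ?thesis
    by unfold_locales (use to_None in \<open>meson rtrancl_trans\<close>)
qed

text \<open>Distances in the join are at most two, and the copies of old vertices keep their
  relation. \<open>None\<close> is adjacent to all of them, and being a twin of
  \<open>Some u\<close> would make \<open>u\<close> universal; so a clique containing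
  \<open>None\<close> is a singleton.\<close>

lemma outer_gp_number_join_K1:
  assumes "pverts G \<noteq> {}" and no_univ: "\<not> (\<exists>h. universal_vertex G h)"
  shows "outer_gp_number (join_K1 G) = clique_number (pverts G) (nonadj_or_twins G)"
proof -
  let ?J = "join_K1 G"
  interpret J: connected_pair_graph ?J by (rule connected_pair_graph_join_K1)
  have "J.d u v \<le> 2" if "u \<in> pverts ?J" "v \<in> pverts ?J" for u v
  proof (cases "u = None \<or> v = None \<or> u = v")
    case True
    then have "u = v \<or> (u, v) \<in> parcs ?J" using that by (auto simp: join_K1_def)
    then show ?thesis using J.rtrancl_parcs[OF that] hop_dist_le_1_iff by fastforce
  next
    case False
    then show ?thesis
      using that by (intro hop_dist_le_2[of _ None]) (auto simp: join_K1_def)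
  qed
  then have J: "outer_gp_number ?J = clique_number (pverts ?J) (nonadj_or_twins ?J)"
    by (rule J.outer_gp_number_diam_le_2)
  have nbhd_Some: "closed_nbhd ?J (Some u) = insert None (Some ` closed_nbhd G u)"
    if "u \<in> pverts G" for u
    using that by (auto simp: closed_nbhd_def join_K1_def)
  have nbhd_None: "closed_nbhd ?J None = insert None (Some ` pverts G)"
    by (auto simp: closed_nbhd_def join_K1_def)
  have Some: "nonadj_or_twins ?J (Some u) (Some v) \<longleftrightarrow> nonadj_or_twins G u v"
    if "u \<in> pverts G" "v \<in> pverts G" for u v
  proof -
    have "(Some u, Some v) \<in> parcs ?J \<longleftrightarrow> (u, v) \<in> parcs G"
      by (auto simp: join_K1_def)
    moreover have "insert None (Some ` A) = insert None (Some ` B) \<longleftrightarrow> A = B" for A B :: "'a set"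
      by auto
    ultimately show ?thesis
      using that by (simp add: nonadj_or_twins_def nbhd_Some)
  qed
  have None: "\<not> nonadj_or_twins ?J None (Some u)" if "u \<in> pverts G" for u
  proof
    assume "nonadj_or_twins ?J None (Some u)"
    moreover have "(None, Some u) \<in> parcs ?J"
      using that by (auto simp: join_K1_def)
    ultimately have "Some ` pverts G \<subseteq> insert None (Some ` closed_nbhd G u)"
      using nbhd_None nbhd_Some[OF that] by (auto simp: nonadj_or_twins_def)
    then have "pverts G \<subseteq> closed_nbhd G u" by auto
    then have "universal_vertex G u"
      using that by (auto simp: universal_vertex_def closed_nbhd_def)
    then show False using no_univ by blast
  qed
  have finJ: "finite (pverts ?J)" by (rule J.pair_finite_verts)
  show ?thesis unfolding J
  proof (rule antisym)
    obtain X where X: "X \<subseteq> pverts ?J" "pairwise (nonadj_or_twins ?J) X"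
      "card X = clique_number (pverts ?J) (nonadj_or_twins ?J)"
      using obtain_max_clique[OF finJ] .
    have "card X \<le> clique_number (pverts G) (nonadj_or_twins G)"
    proof (cases "None \<in> X")
      case True
      have "X = {None}"
      proof (rule ccontr)
        assume "X \<noteq> {None}"
        then obtain u where "Some u \<in> X"
          using True by (auto simp: set_eq_iff)
        moreover from this have "u \<in> pverts G" using X(1) by (auto simp: join_K1_def)
        ultimately show False using None True X(2) unfolding pairwise_def by blast
      qed
      \<comment> \<open>A singleton in \<open>G\<close> matches the clique \<open>{None}\<close>;
        this is where nonemptiness enters.\<close>
      moreover obtain h where "h \<in> pverts G" using assms(1) by auto
      then have "card {h} \<le> clique_number (pverts G) (nonadj_or_twins G)"
        using pair_finite_verts by (intro clique_number_ge) auto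
      ultimately show ?thesis by simp
    next
      case False
      then have sub: "X \<subseteq> Some ` pverts G" using X(1) by (auto simp: join_K1_def)
      then obtain Y where Y: "Y \<subseteq> pverts G" "X = Some ` Y" by (meson subset_imageE)
      have "pairwise (nonadj_or_twins G) Y"
        using X(2) Y Some by (auto simp: pairwise_def subset_iff)
      then have "card Y \<le> clique_number (pverts G) (nonadj_or_twins G)"
        using pair_finite_verts Y(1) by (intro clique_number_ge)
      then show ?thesis using Y(2) by (simp add: card_image)
    qed
    then show "clique_number (pverts ?J) (nonadj_or_twins ?J)
        \<le> clique_number (pverts G) (nonadj_or_twins G)"
      using X(3) by simp
  next
    obtain Y where Y: "Y \<subseteq> pverts G" "pairwise (nonadj_or_twins G) Y"
      "card Y = clique_number (pverts G) (nonadj_or_twins G)"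
      using obtain_max_clique[OF pair_finite_verts] .
    have "card (Some ` Y) \<le> clique_number (pverts ?J) (nonadj_or_twins ?J)"
    proof (rule clique_number_ge[OF finJ])
      show "Some ` Y \<subseteq> pverts ?J" using Y(1) by (auto simp: join_K1_def)
      show "pairwise (nonadj_or_twins ?J) (Some ` Y)"
        using Y(1,2) Some by (auto simp: pairwise_def subset_iff)
    qed
    then show "clique_number (pverts G) (nonadj_or_twins G)
        \<le> clique_number (pverts ?J) (nonadj_or_twins ?J)"
      using Y(3) by (simp add: card_image)
  qed
qed

end

section \<open>The product formula in the three cases\<close>

theorem theorem5p5:
  fixes G :: "'a pair_pre_digraph" and H :: "'b pair_pre_digraph"
  assumes "pair_graph G" and "Digraph_Component.connected (with_proj G)"
    and "card (pverts G) \<ge> 2"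
    and "\<not> (\<exists>u v. true_twins G u v)"
    and "pair_graph H" and "Digraph_Component.connected (with_proj H)"
    and "\<not> complete_digraph (card (pverts H)) (with_proj H)"
  shows "(\<not> (\<exists>h. universal_vertex H h) \<longrightarrow>
            outer_gp_number (lex_product G H) = outer_gp_number G * outer_gp_number (join_K1 H))
       \<and> (graph_diam H = 2 \<longrightarrow>
            outer_gp_number (lex_product G H) = outer_gp_number G * outer_gp_number H)
       \<and> (\<not> (\<exists>u v. true_twins H u v) \<longrightarrow>
            outer_gp_number (lex_product G H) = outer_gp_number G * indep_number H)"
proof -
  interpret G: connected_pair_graph G using assms(1,2) by (rule connected_pair_graphI)
  interpret H: connected_pair_graph H using assms(5,6) by (rule connected_pair_graphI)
  interpret lex_product_graphs G H
    using assms(3,4) by unfold_locales auto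
  \<comment> \<open>Connectedness includes the existence of a vertex.\<close>
  have ne: "pverts H \<noteq> {}"
    using assms(6) by (simp add: connected_conv)
  have "outer_gp_number H = clique_number (pverts H) (nonadj_or_twins H)"
    if "graph_diam H = 2"
    using that H.hop_dist_le_graph_diam[of 2] by (intro H.outer_gp_number_diam_le_2) simp
  then show ?thesis
    using outer_gp_number_lex_product H.outer_gp_number_join_K1[OF ne] H.indep_number_no_twins
    by simp
qed

end
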